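(* Let $I\subseteq\mathbb{R}$ be an interval and let $\mathcal{F}=(f_x\colon I\to\mathbb{R})_{x\in[0,1]}$ be an admissible family. Then both $\mathscr{L}_{\mathcal{F}}\colon\mathcal{P}(I)\to I$ and $\mathscr{U}_{\mathcal{F}}\colon\mathcal{P}(I)\to I$ are $\mathbf{A}_{\mathcal{F}}$-invariant means. Moreover, for every $\mathbf{A}_{\mathcal{F}}$-invariant mean $M\colon\mathcal{P}(I)\to I$ the inequality $\mathscr{L}_{\mathcal{F}}(\mathbb{P})\le M(\mathbb{P})\le\mathscr{U}_{\mathcal{F}}(\mathbb{P})$ holds for all $\mathbb{P}\in\mathcal{P}(I)$.
   Context: Let $I\subseteq\mathbb{R}$ be an interval. $\mathcal{P}(I)$ denotes the family of all compactly supported probability measures on the Borel $\sigma$-algebra $\mathcal{B}(I)$. For $\mathbb{P}\in\mathcal{P}(I)$ put $\gamma(\mathbb{P}):=[\inf\operatorname{supp}\mathbb{P},\sup\operatorname{supp}\mathbb{P}]$. A (integral) mean on $I$ is a function $M\colon\mathcal{P}(I)\to I$ with $M(\mathbb{P})\in\gamma(\mathbb{P})$ for all $\mathbb{P}\in\mathcal{P}(I)$. For a continuous, strictly monotone $f\colon I\to\mathbb{R}$, the quasiarithmetic mean $\mathscr{A}^{[f]}\colon\mathcal{P}(I)\to I$ is $\mathscr{A}^{[f]}(\mathbb{P}):=f^{-1}\big(\int f(x)\,d\mathbb{P}(x)\big)$. A family $\mathcal{F}=(f_x)_{x\in[0,1]}$ of functions $f_x\colon I\to\mathbb{R}$ is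 admissible if (1) each $f_x$ is continuous and strictly monotone, and (2) the function $I\times[0,1]\ni(t,x)\mapsto f_x(t)$ is measurable with respect to the product $\sigma$-algebra $\mathcal{B}(I)\times\mathcal{L}[0,1]$, where $\mathcal{L}[0,1]$ is the Lebesgue $\sigma$-algebra on $[0,1]$. For an admissible family $\mathcal{F}$ and $\mathbb{P}\in\mathcal{P}(I)$, $\mathbf{A}_{\mathcal{F}}(\mathbb{P})$ is the Borel measure $S\mapsto|\{x\in[0,1]\colon\mathscr{A}^{[f_x]}(\mathbb{P})\in S\}|$, where $|\cdot|$ is Lebesgue measure; it is an element of $\mathcal{P}(I)$, so $\mathbf{A}_{\mathcal{F}}$ is a selfmap of $\mathcal{P}(I)$, and $\mathbf{A}_{\mathcal{F}}^n$ denotes its $n$-th iterate. A mean $M\colon\mathcal{P}(I)\to I$ is $\mathbf{A}_{\mathcal{F}}$-invariant if $M\circ\mathbf{A}_{\mathcal{F}}=M$. The lower- and upper-invariant means are defined by $$\mathscr{L}_{\mathcal{F}}(\mathbb{P}):=\lim_{n\to\infty}\inf\gamma(\mathbf{A}_{\mathcal{F}}^n(\mathbb{P})),\qquad \mathscr{U}_{\mathcal{F}}(\mathbb{P}):=\lim_{n\to\infty}\sup\gamma(\mathbf{A}_{\mathcal{F}}^n(\mathbb{P})).$$ *)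

theory Defs
  imports "HOL-Probability.Probability"
begin

text \<open>The topological support, relative to the space of \<open>P\<close>. Compactness is absolute, so a measure on
  an open interval whose support accumulates at an excluded endpoint is not compactly supported.\<close>

definition measure_support :: "real measure \<Rightarrow> real set" where
  "measure_support P = {x \<in> space P. \<forall>U. open U \<longrightarrow> x \<in> U \<longrightarrow> emeasure P (U \<inter> space P) > 0}"

definition compact_prob_measures :: "real set \<Rightarrow> real measure set" where
  "compact_prob_measures I =
     {P. sets P = sets (restrict_space borel I) \<and> prob_space P \<and> compact (measure_support P)}"

definition gamma :: "real measure \<Rightarrow> real set" where
  "gamma P = {Inf (measure_support P)..Sup (measure_support P)}"

definition is_mean :: "real set \<Rightarrow> (real measure \<Rightarrow> real) \<Rightarrow> bool" where
  "is_mean I M \<longleftrightarrow> M \<in> compact_prob_measures I \<rightarrow> I \<and> (\<forall>P\<in>compact_prob_measures I. M P \<in> gamma P)"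

definition quasiarithmetic_mean :: "real set \<Rightarrow> (real \<Rightarrow> real) \<Rightarrow> real measure \<Rightarrow> real" where
  "quasiarithmetic_mean I f P = the_inv_into I f (\<integral>t. f t \<partial>P)"

text \<open>A family is written with the index first: \<open>f x t\<close> stands for $f_x(t)$.
  Only the values for \<open>x \<in> {0..1}\<close> and \<open>t \<in> I\<close> matter.\<close>

definition admissible :: "real set \<Rightarrow> (real \<Rightarrow> real \<Rightarrow> real) \<Rightarrow> bool" where
  "admissible I f \<longleftrightarrow>
     (\<forall>x\<in>{0..1}. continuous_on I (f x) \<and> (strict_mono_on I (f x) \<or> strict_antimono_on I (f x))) \<and>
     (\<lambda>(t, x). f x t) \<in> borel_measurable (restrict_space borel I \<Otimes>\<^sub>M lebesgue_on {0..1})"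

text \<open>For an admissible family and \<open>P \<in> compact_prob_measures I\<close> the map under \<open>distr\<close> is
  measurable, so \<open>A_map I f P\<close> assigns to \<open>S\<close> the Lebesgue measure of the set of \<open>x \<in> {0..1}\<close>
  whose quasiarithmetic mean lies in \<open>S\<close>.\<close>

definition A_map :: "real set \<Rightarrow> (real \<Rightarrow> real \<Rightarrow> real) \<Rightarrow> real measure \<Rightarrow> real measure" where
  "A_map I f P =
     distr (lebesgue_on {0..1}) (restrict_space borel I) (\<lambda>x. quasiarithmetic_mean I (f x) P)"

definition is_invariant_mean ::
    "real set \<Rightarrow> (real \<Rightarrow> real \<Rightarrow> real) \<Rightarrow> (real measure \<Rightarrow> real) \<Rightarrow> bool" where
  "is_invariant_mean I f M \<longleftrightarrow>
     is_mean I M \<and> (\<forall>P\<in>compact_prob_measures I. M (A_map I f P) = M P)"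

text \<open>The intervals \<open>gamma ((A_map I f ^^ n) P)\<close> are nested, so both limits below exist for
  admissible families and \<open>P \<in> compact_prob_measures I\<close>.\<close>

definition lower_invariant_mean ::
    "real set \<Rightarrow> (real \<Rightarrow> real \<Rightarrow> real) \<Rightarrow> real measure \<Rightarrow> real" where
  "lower_invariant_mean I f P = lim (\<lambda>n. Inf (gamma ((A_map I f ^^ n) P)))"

definition upper_invariant_mean ::
    "real set \<Rightarrow> (real \<Rightarrow> real \<Rightarrow> real) \<Rightarrow> real measure \<Rightarrow> real" where
  "upper_invariant_mean I f P = lim (\<lambda>n. Sup (gamma ((A_map I f ^^ n) P)))"

end

theory Submission
  imports Defs
begin

text \<open>For \<open>P\<close> in \<open>compact_prob_measures I\<close> each quasiarithmetic mean of \<open>P\<close> lies in \<open>gamma P\<close>, so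
  \<open>A_map I f P\<close> is concentrated on \<open>gamma P\<close> and the intervals \<open>gamma ((A_map I f ^^ n) P)\<close> are
  nested. Their endpoints therefore converge inside \<open>gamma P\<close>, and shifting the index by one leaves
  the limits unchanged. An invariant mean takes the same value at all iterates, and this value lies
  in all of the intervals.\<close>

section \<open>Supports and the intervals \<open>gamma P\<close>\<close>

lemma Compl_measure_support:
  "space P - measure_support P = space P \<inter> \<Union>{U. open U \<and> emeasure P (U \<inter> space P) = 0}"
  by (auto simp: measure_support_def)

text \<open>A support is closed only relative to \<open>space P\<close>. Inside a compact
  \<open>K\<close> contained in the space it becomes \<open>K\<close> minus the open union of all
  open null sets, hence compact.\<close>

lemma compact_measure_support:
  assumes "measure_support P \<subseteq> K" "compact K" "K \<subseteq> space P"
  shows "compact (measure_support P)"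
proof -
  define N where "N = \<Union>{U. open U \<and> emeasure P (U \<inter> space P) = 0}"
  have "measure_support P = K - N"
    using Compl_measure_support[of P] assms(1,3) unfolding N_def[symmetric]
    by (auto simp: measure_support_def)
  moreover have "open N"
    unfolding N_def by blast
  ultimately show ?thesis
    using assms(2) by (simp add: compact_diff)
qed

text \<open>The complement of the support is covered by possibly uncountably many open null sets.
  The Lindelof property replaces this family by a countable subfamily with the same union, so the
  complement is null.\<close>

lemma AE_in_measure_support:
  assumes "sets P = sets (restrict_space borel I)"
  shows "AE t in P. t \<in> measure_support P"
proof -
  define F where "F = {U. open U \<and> emeasure P (U \<inter> space P) = 0}"
  obtain F' where F': "F' \<subseteq> F" "countable F'" "\<Union>F' = \<Union>F"
    by (rule Lindelof[of F]) (simp add: F_def)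
  have "AE t in P. t \<notin> U" if "U \<in> F'" for U
  proof (rule AE_I)
    have U: "open U" "emeasure P (U \<inter> space P) = 0"
      using that F'(1) by (auto simp: F_def)
    have "U \<inter> I \<in> sets (restrict_space borel I)"
      using U(1) by (auto simp: sets_restrict_space)
    then show "U \<inter> space P \<in> sets P"
      unfolding sets_eq_imp_space_eq[OF assms] assms by (simp add: space_restrict_space)
    show "emeasure P (U \<inter> space P) = 0"
      by (rule U(2))
  qed auto
  then have ae: "AE t in P. \<forall>U\<in>F'. t \<notin> U"
    unfolding AE_ball_countable[OF F'(2)] by blast
  have *: "t \<in> measure_support P" if "t \<in> space P" "\<forall>U\<in>F'. t \<notin> U" for t
  proof -
    have "t \<notin> \<Union>F"
      using that(2) unfolding F'(3)[symmetric] by simp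
    then show ?thesis
      using that(1) Compl_measure_support[of P] unfolding F_def by blast
  qed
  show ?thesis
    by (rule AE_mp[OF ae], rule AE_I2) (use * in blast)
qed

lemma compact_prob_measuresD:
  assumes "P \<in> compact_prob_measures I"
  shows "prob_space P" "sets P = sets (restrict_space borel I)" "space P = I"
  using assms sets_eq_imp_space_eq[of P "restrict_space borel I"]
  by (auto simp: compact_prob_measures_def space_restrict_space)

lemma measure_support_endpoints:
  assumes "P \<in> compact_prob_measures I"
  shows "Inf (measure_support P) \<in> measure_support P" "Sup (measure_support P) \<in> measure_support P"
    and "measure_support P \<subseteq> gamma P"
proof -
  interpret prob_space P
    by (rule compact_prob_measuresD(1)[OF assms])
  have cpt: "compact (measure_support P)"
    using assms by (simp add: compact_prob_measures_def)
  \<comment> \<open>An empty support would make \<open>False\<close> hold almost everywhere, which a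
    probability measure excludes.\<close>
  have ne: "measure_support P \<noteq> {}"
    using AE_in_measure_support[OF compact_prob_measuresD(2)[OF assms]] by (auto simp: AE_False)
  have bdd: "bdd_below (measure_support P)" "bdd_above (measure_support P)"
    using compact_imp_bounded[OF cpt] by (auto simp: bounded_imp_bdd_below bounded_imp_bdd_above)
  show "Inf (measure_support P) \<in> measure_support P" "Sup (measure_support P) \<in> measure_support P"
    using closed_contains_Inf[OF ne bdd(1)] closed_contains_Sup[OF ne bdd(2)]
      compact_imp_closed[OF cpt] by blast+
  show "measure_support P \<subseteq> gamma P"
    using bdd by (auto simp: gamma_def intro: cInf_lower cSup_upper)
qed

text \<open>Both endpoints are attained in the compact support and therefore belong to
  \<open>I\<close>, even when \<open>I\<close> is not closed; the interval property of
  \<open>I\<close> supplies the points between.\<close>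

lemma gamma_eq_interval:
  assumes "is_interval I" "P \<in> compact_prob_measures I"
  obtains a b where "a \<le> b" "gamma P = {a..b}" "{a..b} \<subseteq> I"
    "Inf (measure_support P) = a" "Sup (measure_support P) = b"
proof
  let ?a = "Inf (measure_support P)" and ?b = "Sup (measure_support P)"
  note ends = measure_support_endpoints[OF assms(2)]
  have "?a \<in> gamma P"
    using ends by blast
  then show "?a \<le> ?b"
    by (simp add: gamma_def)
  have "measure_support P \<subseteq> I"
    unfolding measure_support_def compact_prob_measuresD(3)[OF assms(2)] by blast
  then have "?a \<in> I" "?b \<in> I"
    using ends(1,2) by blast+
  then show "{?a..?b} \<subseteq> I"
    using assms(1) unfolding is_interval_1 by (meson atLeastAtMost_iff subsetI)
qed (simp_all add: gamma_def)

text \<open>The invariant means are built from \<open>Inf (gamma P)\<close> and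
  \<open>Sup (gamma P)\<close>; since \<open>gamma P\<close> is a nonempty closed interval, these
  recover its endpoints.\<close>

lemma Inf_gamma_Sup_gamma:
  assumes "is_interval I" "P \<in> compact_prob_measures I"
  shows "gamma P = {Inf (gamma P)..Sup (gamma P)}" "Inf (gamma P) \<le> Sup (gamma P)"
    "gamma P \<subseteq> I"
proof -
  obtain a b where "a \<le> b" "gamma P = {a..b}" "{a..b} \<subseteq> I"
    using gamma_eq_interval[OF assms] by blast
  then show "gamma P = {Inf (gamma P)..Sup (gamma P)}" "Inf (gamma P) \<le> Sup (gamma P)"
    "gamma P \<subseteq> I"
    by simp_all
qed

lemma AE_in_gamma:
  assumes "P \<in> compact_prob_measures I"
  shows "AE t in P. t \<in> gamma P"
  using AE_in_measure_support[OF compact_prob_measuresD(2)[OF assms]]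
  by (rule eventually_mono) (use measure_support_endpoints(3)[OF assms] in blast)

section \<open>Quasiarithmetic means and the selfmap they induce\<close>

lemma quasiarithmetic_mean:
  assumes I: "is_interval I" and P: "P \<in> compact_prob_measures I"
    and g: "continuous_on I g" "inj_on g I"
  shows "quasiarithmetic_mean I g P \<in> gamma P"
    and "g (quasiarithmetic_mean I g P) = (\<integral>t. g t \<partial>P)"
proof -
  interpret prob_space P
    by (rule compact_prob_measuresD(1)[OF P])
  obtain a b where ab: "a \<le> b" "gamma P = {a..b}" "{a..b} \<subseteq> I"
    using gamma_eq_interval[OF I P] by blast
  \<comment> \<open>By continuity \<open>g\<close> maps \<open>gamma P\<close> onto a compact
    interval. As \<open>P\<close> is concentrated on \<open>gamma P\<close>, the integral of
    \<open>g\<close> lies in that interval and is thus a value of \<open>g\<close> on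
    \<open>gamma P\<close>.\<close>
  obtain p q where pq: "g ` {a..b} = {p..q}"
    using continuous_image_closed_interval[OF ab(1)] continuous_on_subset[OF g(1) ab(3)] by blast
  have ae: "AE t in P. g t \<in> {p..q}"
    using AE_in_gamma[OF P] by (rule eventually_mono) (use pq ab(2) in blast)
  have meas: "g \<in> borel_measurable P"
    using borel_measurable_continuous_on_restrict[OF g(1)] compact_prob_measuresD(2)[OF P]
      measurable_cong_sets by blast
  \<comment> \<open>On \<open>I\<close> the function \<open>g\<close> may be unbounded, but it is
    bounded on \<open>gamma P\<close>, and this is enough for integrability.\<close>
  have "AE t in P. norm (g t) \<le> max \<bar>p\<bar> \<bar>q\<bar>"
    using ae by (rule eventually_mono) auto
  then have int: "integrable P g"
    using meas by (rule integrable_const_bound)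
  have "(\<integral>t. g t \<partial>P) \<in> {p..q}"
    using integral_ge_const[OF int, of p] integral_le_const[OF int, of q] ae by auto
  then obtain m where m: "m \<in> {a..b}" "g m = (\<integral>t. g t \<partial>P)"
    unfolding pq[symmetric] by auto
  \<comment> \<open>Injectivity on \<open>I\<close> makes \<open>the_inv_into\<close> return this
    very point.\<close>
  then have "quasiarithmetic_mean I g P = m"
    unfolding quasiarithmetic_mean_def using the_inv_into_f_eq[OF g(2)] ab(3) by blast
  then show "quasiarithmetic_mean I g P \<in> gamma P"
    and "g (quasiarithmetic_mean I g P) = (\<integral>t. g t \<partial>P)"
    using m ab(2) by auto
qed

lemma admissibleD:
  assumes "admissible I f" "x \<in> {0..1}"
  shows "continuous_on I (f x)" "inj_on (f x) I"
    "strict_mono_on I (f x) \<or> strict_antimono_on I (f x)"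
  using assms strict_antimono_iff_antimono[of I "f x"]
  by (auto simp: admissible_def intro: strict_mono_on_imp_inj_on)

text \<open>Monotonicity turns \<open>?A x \<le> c\<close> into a comparison of the integral of
  \<open>f x\<close> with \<open>f x c\<close>, which avoids inverting \<open>f x\<close> measurably
  in \<open>x\<close>. Both quantities are measurable in \<open>x\<close>: one is a parameter
  integral of a jointly measurable function, the other a section of it.\<close>

lemma borel_measurable_quasiarithmetic_mean:
  assumes I: "is_interval I" and f: "admissible I f" and P: "P \<in> compact_prob_measures I"
  shows "(\<lambda>x. quasiarithmetic_mean I (f x) P) \<in> borel_measurable (lebesgue_on {0..1})"
    (is "?A \<in> borel_measurable ?L")
proof (rule borel_measurableI_le)
  fix c
  interpret prob_space P
    by (rule compact_prob_measuresD(1)[OF P])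
  obtain a b where ab: "a \<le> b" "gamma P = {a..b}" "{a..b} \<subseteq> I"
    using gamma_eq_interval[OF I P] by blast
  have spL: "space ?L = {0..1}"
    by simp
  have A: "?A x \<in> {a..b}" "f x (?A x) = (\<integral>t. f x t \<partial>P)" if "x \<in> {0..1}" for x
    using quasiarithmetic_mean[OF I P admissibleD(1,2)[OF f that]] ab by auto
  have "(\<lambda>(t, x). f x t) \<in> borel_measurable (P \<Otimes>\<^sub>M ?L)"
    using f compact_prob_measuresD(2)[OF P]
    by (simp add: admissible_def cong: measurable_cong_sets sets_pair_measure_cong)
  then have joint: "(\<lambda>(x, t). f x t) \<in> borel_measurable (?L \<Otimes>\<^sub>M P)"
    using measurable_pair_swap by fastforce
  then have int: "(\<lambda>x. \<integral>t. f x t \<partial>P) \<in> borel_measurable ?L"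
    by (rule borel_measurable_lebesgue_integral)
  have sec: "(\<lambda>x. f x d) \<in> borel_measurable ?L" if "d \<in> I" for d
    using measurable_compose[OF measurable_Pair2'[of d P ?L] joint] that
      compact_prob_measuresD(3)[OF P] by simp
  \<comment> \<open>All values of \<open>?A\<close> lie in \<open>{a..b}\<close>, so the first two
    cases give the empty set and the whole space. In the third case \<open>c\<close> and
    \<open>b\<close> are distinct points of \<open>I\<close>, at which the direction of
    \<open>f x\<close> can be read off.\<close>
  consider "c < a" | "b \<le> c" | "a \<le> c" "c < b"
    by linarith
  then show "{x \<in> space ?L. ?A x \<le> c} \<in> sets ?L"
  proof cases
    case 1
    then have "{x \<in> space ?L. ?A x \<le> c} = {}"
      using A(1) by (force simp: spL)
    then show ?thesis
      by (simp only: sets.empty_sets)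
  next
    case 2
    then have "{x \<in> space ?L. ?A x \<le> c} = space ?L"
      using A(1) by (force simp: spL)
    then show ?thesis
      by (simp only: sets.top)
  next
    case 3
    then have cb: "c \<in> I" "b \<in> I"
      using ab by auto
    \<comment> \<open>The factor \<open>f x b - f x c\<close> treats increasing and decreasing \<open>f x\<close> at once.\<close>
    have "?A x \<le> c \<longleftrightarrow> ((\<integral>t. f x t \<partial>P) - f x c) * (f x b - f x c) \<le> 0" if x: "x \<in> {0..1}" for x
    proof -
      have AI: "?A x \<in> I"
        using A(1)[OF x] ab(3) by auto
      have *: "h y < h z \<longleftrightarrow> y < z" "h y \<le> h z \<longleftrightarrow> y \<le> z"
        if "strict_mono_on I h" "y \<in> I" "z \<in> I" for h :: "real \<Rightarrow> real" and y z
        using that by (simp_all add: strict_mono_on_less strict_mono_on_less_eq)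
      show ?thesis
        using admissibleD(3)[OF f x]
      proof
        assume "strict_mono_on I (f x)"
        from *(1)[OF this cb] *(2)[OF this AI cb(1)] show ?thesis
          unfolding A(2)[OF x, symmetric] using 3(2) by (simp add: mult_le_0_iff)
      next
        assume "strict_antimono_on I (f x)"
        then have "strict_mono_on I (\<lambda>t. - f x t)"
          by (simp add: monotone_on_def)
        from *(1)[OF this cb] *(2)[OF this AI cb(1)] show ?thesis
          unfolding A(2)[OF x, symmetric] using 3(2) by (simp add: mult_le_0_iff)
      qed
    qed
    then have "{x \<in> space ?L. ?A x \<le> c} =
        {x \<in> space ?L. ((\<integral>t. f x t \<partial>P) - f x c) * (f x b - f x c) \<le> 0}"
      unfolding spL by blast
    also have "\<dots> \<in> sets ?L"
      using int sec[OF cb(1)] sec[OF cb(2)] by measurable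
    finally show ?thesis .
  qed
qed

text \<open>Every quasiarithmetic mean lies in \<open>gamma P\<close>, so the open complement of
  \<open>gamma P\<close> has an empty preimage and measure zero. The new support thus lies in a
  compact subset of \<open>I\<close>, which yields both its compactness and the nesting.\<close>

lemma A_map:
  assumes I: "is_interval I" and f: "admissible I f" and P: "P \<in> compact_prob_measures I"
  shows "A_map I f P \<in> compact_prob_measures I" "gamma (A_map I f P) \<subseteq> gamma P"
proof -
  obtain a b where ab: "a \<le> b" "gamma P = {a..b}" "{a..b} \<subseteq> I"
    using gamma_eq_interval[OF I P] by blast
  let ?L = "lebesgue_on {0..1::real}" and ?A = "\<lambda>x. quasiarithmetic_mean I (f x) P"
  let ?Q = "A_map I f P"
  have A: "?A x \<in> {a..b}" if "x \<in> {0..1}" for x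
    using quasiarithmetic_mean(1)[OF I P admissibleD(1,2)[OF f that]] ab by auto
  have meas: "?A \<in> measurable ?L (restrict_space borel I)"
    using borel_measurable_quasiarithmetic_mean[OF assms] A ab(3)
    by (intro measurable_restrict_space2) auto
  have sp: "space ?Q = I"
    by (simp add: A_map_def space_restrict_space)
  have L: "prob_space ?L"
    by (rule prob_spaceI) (simp add: emeasure_restrict_space)
  have Q: "prob_space ?Q"
    unfolding A_map_def by (rule prob_space.prob_space_distr[OF L meas])
  have supp: "measure_support ?Q \<subseteq> {a..b}"
  proof
    fix t assume t: "t \<in> measure_support ?Q"
    show "t \<in> {a..b}"
    proof (rule ccontr)
      assume "t \<notin> {a..b}"
      then have "emeasure ?Q (- {a..b} \<inter> I) > 0"
        using t sp open_Compl[OF closed_atLeastAtMost]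
        unfolding measure_support_def mem_Collect_eq by (metis ComplI)
      moreover have "?A -` (- {a..b} \<inter> I) \<inter> space ?L = {}"
        using A by auto
      moreover have "- {a..b} \<inter> I \<in> sets (restrict_space borel I)"
        by (auto simp: sets_restrict_space)
      ultimately show False
        unfolding A_map_def by (simp add: emeasure_distr[OF meas])
    qed
  qed
  then have "compact (measure_support ?Q)"
    using compact_measure_support[OF _ compact_Icc] ab(3) sp by simp
  then show Q': "?Q \<in> compact_prob_measures I"
    using Q by (simp add: compact_prob_measures_def) (simp add: A_map_def)
  show "gamma ?Q \<subseteq> gamma P"
    using measure_support_endpoints(1,2)[OF Q'] supp unfolding ab(2) unfolding gamma_def by fastforce
qed

section \<open>Iterates and invariant means\<close>

lemma A_map_funpow_in_compact_prob_measures: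
  assumes "is_interval I" "admissible I f" "P \<in> compact_prob_measures I"
  shows "(A_map I f ^^ n) P \<in> compact_prob_measures I"
  by (induction n) (use A_map(1)[OF assms(1,2)] assms(3) in auto)

lemma gamma_A_map_funpow_antimono:
  assumes "is_interval I" "admissible I f" "P \<in> compact_prob_measures I"
  shows "antimono (\<lambda>n. gamma ((A_map I f ^^ n) P))"
  unfolding antimono_iff_le_Suc
  using A_map(2)[OF assms(1,2) A_map_funpow_in_compact_prob_measures[OF assms]] by simp

text \<open>\<open>lim\<close> is an actual limit only once convergence is known. Nested intervals
  have increasing lower and decreasing upper endpoints, all contained in the first interval, hence
  convergent.\<close>

lemma lower_upper_invariant_mean_limits:
  assumes I: "is_interval I" and f: "admissible I f" and P: "P \<in> compact_prob_measures I"
  shows "(\<lambda>n. Inf (gamma ((A_map I f ^^ n) P))) \<longlonglongrightarrow> lower_invariant_mean I f P"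
    and "(\<lambda>n. Sup (gamma ((A_map I f ^^ n) P))) \<longlonglongrightarrow> upper_invariant_mean I f P"
    and "lower_invariant_mean I f P \<in> gamma P"
    and "upper_invariant_mean I f P \<in> gamma P"
proof -
  define l u where "l n = Inf (gamma ((A_map I f ^^ n) P))"
    and "u n = Sup (gamma ((A_map I f ^^ n) P))" for n
  have G: "gamma ((A_map I f ^^ n) P) = {l n..u n}" "l n \<le> u n" for n
    unfolding l_def u_def
    by (rule Inf_gamma_Sup_gamma[OF I A_map_funpow_in_compact_prob_measures[OF assms]])+
  have "{l n..u n} \<subseteq> {l m..u m}" if "m \<le> n" for m n
    using antimonoD[OF gamma_A_map_funpow_antimono[OF assms] that] unfolding G(1) .
  \<comment> \<open>Inclusion of closed intervals orders their endpoints only if the smaller one is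
    nonempty, which is where \<open>l n \<le> u n\<close> enters.\<close>
  then have mono: "l m \<le> l n" "u n \<le> u m" if "m \<le> n" for m n
    using that G(2)[of n] by fastforce+
  have bounds: "l 0 \<le> l n" "l n \<le> u 0" "l 0 \<le> u n" "u n \<le> u 0" for n
    using mono[of 0 n] G(2)[of n] by simp_all
  have "convergent l"
    using bounds mono(1) by (intro Bseq_mono_convergent Limits.Bseq_eq_bounded[of _ "l 0" "u 0"]) auto
  then have l: "l \<longlonglongrightarrow> lower_invariant_mean I f P"
    unfolding lower_invariant_mean_def convergent_LIMSEQ_iff l_def .
  have "convergent u"
    using bounds mono(2)
    by (intro Bseq_monoseq_convergent Limits.Bseq_eq_bounded[of _ "l 0" "u 0"]) (auto simp: monoseq_def)
  then have u: "u \<longlonglongrightarrow> upper_invariant_mean I f P"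
    unfolding upper_invariant_mean_def convergent_LIMSEQ_iff u_def .
  show "(\<lambda>n. Inf (gamma ((A_map I f ^^ n) P))) \<longlonglongrightarrow> lower_invariant_mean I f P"
    using l unfolding l_def .
  show "(\<lambda>n. Sup (gamma ((A_map I f ^^ n) P))) \<longlonglongrightarrow> upper_invariant_mean I f P"
    using u unfolding u_def .
  \<comment> \<open>The zeroth iterate is \<open>P\<close> itself, so the uniform bounds
    \<open>l 0\<close> and \<open>u 0\<close> on all terms put both limits in
    \<open>gamma P\<close>.\<close>
  have "gamma P = {l 0..u 0}"
    using G(1)[of 0] by simp
  then show "lower_invariant_mean I f P \<in> gamma P" "upper_invariant_mean I f P \<in> gamma P"
    using LIMSEQ_le_const[OF l] LIMSEQ_le_const2[OF l] LIMSEQ_le_const[OF u] LIMSEQ_le_const2[OF u]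
      bounds by auto
qed

theorem theorem1:
  fixes I :: "real set" and f :: "real \<Rightarrow> real \<Rightarrow> real"
  assumes "is_interval I" and "admissible I f"
  shows "is_invariant_mean I f (lower_invariant_mean I f) \<and>
         is_invariant_mean I f (upper_invariant_mean I f) \<and>
         (\<forall>M. is_invariant_mean I f M \<longrightarrow>
            (\<forall>P\<in>compact_prob_measures I.
               lower_invariant_mean I f P \<le> M P \<and> M P \<le> upper_invariant_mean I f P))"
proof (intro conjI allI impI ballI)
  note lim = lower_upper_invariant_mean_limits[OF assms]
  \<comment> \<open>The \<open>n\<close>-th iterate starting at \<open>A_map I f P\<close> is the
    iterate of order \<open>Suc n\<close> starting at \<open>P\<close>, so the two sides are limits
    of a sequence and of its tail.\<close>
  have "lower_invariant_mean I f (A_map I f P) = lower_invariant_mean I f P"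
    "upper_invariant_mean I f (A_map I f P) = upper_invariant_mean I f P"
    if P: "P \<in> compact_prob_measures I" for P
    using LIMSEQ_unique[OF lim(1)[OF A_map(1)[OF assms P]]] LIMSEQ_Suc[OF lim(1)[OF P]]
      LIMSEQ_unique[OF lim(2)[OF A_map(1)[OF assms P]]] LIMSEQ_Suc[OF lim(2)[OF P]]
    by (simp_all add: funpow_swap1)
  then show "is_invariant_mean I f (lower_invariant_mean I f)"
    "is_invariant_mean I f (upper_invariant_mean I f)"
    using lim(3,4) Inf_gamma_Sup_gamma(3)[OF assms(1)]
    unfolding is_invariant_mean_def is_mean_def by blast+
next
  fix M P assume M: "is_invariant_mean I f M" and P: "P \<in> compact_prob_measures I"
  note iter = A_map_funpow_in_compact_prob_measures[OF assms P]
  \<comment> \<open>Invariance applies at each iterate because every iterate is again in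
    \<open>compact_prob_measures I\<close>.\<close>
  have "M ((A_map I f ^^ n) P) = M P" for n
    by (induction n) (use M iter in \<open>auto simp: is_invariant_mean_def\<close>)
  then have "M P \<in> gamma ((A_map I f ^^ n) P)" for n
    using M iter by (metis is_invariant_mean_def is_mean_def)
  then have *: "Inf (gamma ((A_map I f ^^ n) P)) \<le> M P" "M P \<le> Sup (gamma ((A_map I f ^^ n) P))" for n
    using Inf_gamma_Sup_gamma(1)[OF assms(1) iter] by (metis atLeastAtMost_iff)+
  \<comment> \<open>Each inequality holds for every \<open>n\<close> and so survives passage to the
    limit.\<close>
  show "lower_invariant_mean I f P \<le> M P"
    using LIMSEQ_le_const2[OF lower_upper_invariant_mean_limits(1)[OF assms P]] *(1) by blast
  show "M P \<le> upper_invariant_mean I f P"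
    using LIMSEQ_le_const[OF lower_upper_invariant_mean_limits(2)[OF assms P]] *(2) by blast
qed

end
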